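(* Let $d\ge1$. Let $\alpha,\beta,\gamma\in\mathbb R\setminus\{0\}$ and $s\in\mathbb R$ satisfy one of the following: (i) $\beta+\gamma=0$ and $s\ne0$; (ii) $\alpha-\gamma=0$ and $s<0$. Then norm inflation in $\mathcal H^s(\mathbb T^d)$ occurs for the system $$(i\partial_t+\alpha\Delta)u=-(\nabla\cdot w)v,\quad (i\partial_t+\beta\Delta)v=-(\nabla\cdot\overline w)u,\quad (i\partial_t+\gamma\Delta)w=\nabla(u\cdot\overline v)\qquad (t>0,\ x\in\mathbb T^d).$$ More precisely, there exist a sequence $\{(u_n,v_n,w_n)\}$ of solutions of this system and a sequence $\{t_n\}$ of positive numbers such that $$\lim_{n\to\infty}t_n=0,\qquad \lim_{n\to\infty}\|(u_n(0),v_n(0),w_n(0))\|_{\mathcal H^s}=0,\qquad \lim_{n\to\infty}\|(u_n(t_n),v_n(t_n),w_n(t_n))\|_{\mathcal H^s}=\infty.$$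
   Context: $\mathbb T=\mathbb R/2\pi\mathbb Z$; $u,v,w$ are $\mathbb C^d$-valued; $u\cdot\overline v=\sum_ju_j\overline{v_j}$. $\mathcal H^s(\mathbb T^d)=(H^s(\mathbb T^d))^d\times(H^s(\mathbb T^d))^d\times(H^s(\mathbb T^d))^d$. Solutions are understood as classical (smooth) solutions on a time interval containing $[0,t_n]$. *)

theory Defs
  imports "HOL-Analysis.Analysis"
begin

text \<open>Functions on \<open>\<T>\<^sup>d\<close> are represented by functions on \<open>real ^ 'd\<close> that are \<open>2\<pi>\<close>-periodic in
  every coordinate.\<close>

definition torus_periodic :: "(real ^ 'd \<Rightarrow> 'b) \<Rightarrow> bool"
  where "torus_periodic f \<longleftrightarrow> (\<forall>x j. f (x + axis j (2 * pi)) = f x)"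

text \<open>\<open>C\<^sup>k\<close> and \<open>C\<^sup>\<infinity>\<close> on a convex set with nonempty interior, one-sided at boundary
  points (on such a set the derivative within the set is unique).\<close>

primrec Ck_on :: "nat \<Rightarrow> 'a::real_normed_vector set \<Rightarrow> ('a \<Rightarrow> 'b::real_normed_vector) \<Rightarrow> bool"
  where
    "Ck_on 0 S f \<longleftrightarrow> continuous_on S f"
  | "Ck_on (Suc k) S f \<longleftrightarrow>
       (\<forall>x\<in>S. f differentiable (at x within S)) \<and>
       (\<forall>v. Ck_on k S (\<lambda>x. frechet_derivative f (at x within S) v))"

definition smooth_on :: "'a::real_normed_vector set \<Rightarrow> ('a \<Rightarrow> 'b::real_normed_vector) \<Rightarrow> bool"
  where "smooth_on S f \<longleftrightarrow> (\<forall>k. Ck_on k S f)"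

definition pdv :: "'d \<Rightarrow> (real ^ 'd \<Rightarrow> 'b::real_normed_vector) \<Rightarrow> real ^ 'd \<Rightarrow> 'b"
  where "pdv j f x = frechet_derivative f (at x) (axis j 1)"

definition laplacian :: "(real ^ 'd \<Rightarrow> 'b::real_normed_vector) \<Rightarrow> real ^ 'd \<Rightarrow> 'b"
  where "laplacian f x = (\<Sum>j\<in>UNIV. pdv j (pdv j f) x)"

definition gradient :: "(real ^ 'd \<Rightarrow> complex) \<Rightarrow> real ^ 'd \<Rightarrow> complex ^ 'd"
  where "gradient f x = (\<chi> j. pdv j f x)"

definition divergence :: "(real ^ 'd \<Rightarrow> complex ^ 'd) \<Rightarrow> real ^ 'd \<Rightarrow> complex"
  where "divergence f x = (\<Sum>j\<in>UNIV. pdv j (\<lambda>y. f y $ j) x)"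

definition cnj_vec :: "complex ^ 'd \<Rightarrow> complex ^ 'd"
  where "cnj_vec z = (\<chi> j. cnj (z $ j))"

text \<open>The bilinear product \<open>\<Sum>\<^sub>j a\<^sub>j b\<^sub>j\<close>; the library's \<open>inner\<close> on \<open>complex ^ 'd\<close> is the
  real inner product.\<close>

definition cdot :: "complex ^ 'd \<Rightarrow> complex ^ 'd \<Rightarrow> complex"
  where "cdot a b = (\<Sum>j\<in>UNIV. a $ j * b $ j)"

text \<open>Classical solutions on a time interval \<open>I\<close>. The time derivative is taken within \<open>I\<close>, hence
  one-sided at an endpoint belonging to \<open>I\<close>.\<close>

definition classical_solution ::
  "real \<Rightarrow> real \<Rightarrow> real \<Rightarrow> real set \<Rightarrow> (real \<Rightarrow> real ^ 'd \<Rightarrow> complex ^ 'd) \<Rightarrow>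
   (real \<Rightarrow> real ^ 'd \<Rightarrow> complex ^ 'd) \<Rightarrow> (real \<Rightarrow> real ^ 'd \<Rightarrow> complex ^ 'd) \<Rightarrow> bool"
  where "classical_solution \<alpha> \<beta> \<gamma> I u v w \<longleftrightarrow>
    smooth_on (I \<times> UNIV) (\<lambda>(t, x). u t x) \<and>
    smooth_on (I \<times> UNIV) (\<lambda>(t, x). v t x) \<and>
    smooth_on (I \<times> UNIV) (\<lambda>(t, x). w t x) \<and>
    (\<forall>t\<in>I. torus_periodic (u t) \<and> torus_periodic (v t) \<and> torus_periodic (w t)) \<and>
    (\<forall>t\<in>I. \<forall>x.
      \<i> *s vector_derivative (\<lambda>\<tau>. u \<tau> x) (at t within I) + \<alpha> *\<^sub>R laplacian (u t) x
        = - (divergence (w t) x *s v t x) \<and>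
      \<i> *s vector_derivative (\<lambda>\<tau>. v \<tau> x) (at t within I) + \<beta> *\<^sub>R laplacian (v t) x
        = - (divergence (\<lambda>y. cnj_vec (w t y)) x *s u t x) \<and>
      \<i> *s vector_derivative (\<lambda>\<tau>. w \<tau> x) (at t within I) + \<gamma> *\<^sub>R laplacian (w t) x
        = gradient (\<lambda>y. cdot (u t y) (cnj_vec (v t y))) x)"

definition fourier_coeff :: "(real ^ 'd \<Rightarrow> complex) \<Rightarrow> int ^ 'd \<Rightarrow> complex"
  where "fourier_coeff f k =
    integral (cbox 0 (\<chi> j. 2 * pi)) (\<lambda>x. f x * cis (- (\<Sum>j\<in>UNIV. of_int (k $ j) * x $ j)))
      / of_real ((2 * pi) ^ CARD('d))"

text \<open>The norm of \<open>H\<^sup>s(\<T>\<^sup>d)\<close>. It is used only for smooth periodic functions, for which the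
  series converges for every real \<open>s\<close>; otherwise \<open>infsum\<close> would return 0.\<close>

definition sobolev_norm :: "real \<Rightarrow> (real ^ 'd \<Rightarrow> complex) \<Rightarrow> real"
  where "sobolev_norm s f =
    sqrt (\<Sum>\<^sub>\<infinity>k::int ^ 'd. (1 + (\<Sum>j\<in>UNIV. (of_int (k $ j))\<^sup>2)) powr s * (cmod (fourier_coeff f k))\<^sup>2)"

definition Hs_norm ::
  "real \<Rightarrow> (real ^ 'd \<Rightarrow> complex ^ 'd) \<times> (real ^ 'd \<Rightarrow> complex ^ 'd) \<times> (real ^ 'd \<Rightarrow> complex ^ 'd) \<Rightarrow> real"
  where "Hs_norm s = (\<lambda>(u, v, w).
    sqrt (\<Sum>j\<in>UNIV. (sobolev_norm s (\<lambda>x. u x $ j))\<^sup>2 + (sobolev_norm s (\<lambda>x. v x $ j))\<^sup>2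
                   + (sobolev_norm s (\<lambda>x. w x $ j))\<^sup>2))"

end

theory Submission
  imports Defs "HOL-Real_Asymp.Real_Asymp"
begin

text \<open>All solutions are explicit. Put plane waves of frequencies \<open>m\<^sub>1\<close>, \<open>m\<^sub>2\<close>, \<open>m\<^sub>1 - m\<^sub>2\<close> (in one
  coordinate direction and one component) into \<open>u\<close>, \<open>v\<close>, \<open>w\<close>, each carrying its free phase. The
  nonlinearities preserve this form, and under the resonance
  \<open>\<alpha> m\<^sub>1\<^sup>2 = \<beta> m\<^sub>2\<^sup>2 + \<gamma> (m\<^sub>1 - m\<^sub>2)\<^sup>2\<close> the phases cancel. If \<open>v\<close> and \<open>w\<close> have the same real
  amplitude \<open>b\<close>, then with \<open>q = m\<^sub>1 - m\<^sub>2\<close> there remains \<open>a' = - q b\<^sup>2\<close>, \<open>b' = q a b\<close>, solved by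
  \<open>a = - R tanh \<theta>\<close>, \<open>b = R / cosh \<theta>\<close>, \<open>\<theta> = q R (t - t\<^sub>0)\<close>. The resonance holds for
  \<open>(m\<^sub>1, m\<^sub>2) = (0, - N)\<close> if \<open>\<beta> + \<gamma> = 0\<close> and for \<open>(N, 0)\<close> if \<open>\<alpha> = \<gamma>\<close>. In a short time, amplitude
  \<open>R\<close> moves between the frequencies \<open>0\<close> and \<open>N\<close>, which the \<open>H\<^sup>s\<close> norm weighs very differently.\<close>

section \<open>Smoothness\<close>

text \<open>\<open>Ck_on\<close> recurses on derivatives in one fixed direction at a time, so a
  family closed under directional derivatives is C^k by induction on k. Differentiability gives the
  continuity of the base case.\<close>

lemma smooth_on_UNIV_if_closed_derivatives:
  assumes closed: "\<And>f. f \<in> F \<Longrightarrow> \<exists>D. (\<forall>v. D v \<in> F) \<and> (\<forall>x. (f has_derivative (\<lambda>v. D v x)) (at x))"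
    and "f \<in> F"
  shows "smooth_on UNIV f"
proof -
  have "Ck_on k UNIV f" for k
    using \<open>f \<in> F\<close>
  proof (induction k arbitrary: f)
    case 0
    then obtain D where "\<forall>x. (f has_derivative (\<lambda>v. D v x)) (at x)" using closed by blast
    then show ?case
      by (auto simp: continuous_on_eq_continuous_within intro: has_derivative_continuous)
  next
    case (Suc k)
    then obtain D where D: "\<And>v. D v \<in> F" "\<And>x. (f has_derivative (\<lambda>v. D v x)) (at x)"
      using closed by blast
    then have "frechet_derivative f (at x) = (\<lambda>v. D v x)" for x
      by (metis frechet_derivative_at)
    with D Suc.IH show ?case by (auto simp: differentiable_def)
  qed
  then show ?thesis by (simp add: smooth_on_def)
qed

text \<open>The generators are picked so that differentiation stays inside: cis' is a multiple of
  cis, tanh' = 1 - tanh^2, sech' = - tanh * sech. The offset \<open>c\<close> lets the profiles be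
  centred at a time other than 0.\<close>

inductive_set smooth_algebra :: "('a::real_normed_vector \<Rightarrow> complex) set" where
  const: "(\<lambda>x. c) \<in> smooth_algebra"
| cis: "bounded_linear l \<Longrightarrow> (\<lambda>x. cis (l x)) \<in> smooth_algebra"
| tanh: "bounded_linear l \<Longrightarrow> (\<lambda>x. of_real (tanh (l x + c))) \<in> smooth_algebra"
| sech: "bounded_linear l \<Longrightarrow> (\<lambda>x. of_real (inverse (cosh (l x + c)))) \<in> smooth_algebra"
| add: "f \<in> smooth_algebra \<Longrightarrow> g \<in> smooth_algebra \<Longrightarrow> (\<lambda>x. f x + g x) \<in> smooth_algebra"
| mult: "f \<in> smooth_algebra \<Longrightarrow> g \<in> smooth_algebra \<Longrightarrow> (\<lambda>x. f x * g x) \<in> smooth_algebra"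

lemma has_derivative_sech [derivative_intros]:
  fixes g :: "'a::real_normed_vector \<Rightarrow> real"
  assumes "(g has_derivative g') (at x within S)"
  shows "((\<lambda>x. inverse (cosh (g x))) has_derivative
           (\<lambda>v. - (tanh (g x) * inverse (cosh (g x)) * g' v))) (at x within S)"
proof -
  have "((\<lambda>y. inverse (cosh y)) has_field_derivative - (tanh (g x) * inverse (cosh (g x)))) (at (g x))"
    by (rule derivative_eq_intros refl | simp add: tanh_def divide_simps)+
  from DERIV_compose_FDERIV [OF this assms]
  show ?thesis by (simp add: algebra_simps)
qed

lemma has_derivative_tanh':
  fixes g :: "'a::real_normed_vector \<Rightarrow> real"
  assumes "(g has_derivative g') (at x within S)"
  shows "((\<lambda>x. tanh (g x)) has_derivative (\<lambda>v. (1 - tanh (g x) * tanh (g x)) * g' v)) (at x within S)"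
proof -
  have "(tanh has_field_derivative (1 - tanh (g x) * tanh (g x))) (at (g x))"
    by (rule derivative_eq_intros refl | simp add: power2_eq_square)+
  from DERIV_compose_FDERIV [OF this assms]
  show ?thesis by (simp add: algebra_simps)
qed

lemma has_derivative_cis':
  fixes g :: "'a::real_normed_vector \<Rightarrow> real"
  assumes "(g has_derivative g') (at x within S)"
  shows "((\<lambda>x. cis (g x)) has_derivative (\<lambda>v. \<i> * of_real (g' v) * cis (g x))) (at x within S)"
  using has_derivative_cis [OF assms] by (simp add: scaleR_conv_of_real mult_ac)

lemma smooth_algebra_derivative:
  assumes "f \<in> smooth_algebra"
  shows "\<exists>D. (\<forall>v. D v \<in> smooth_algebra) \<and> (\<forall>x. (f has_derivative (\<lambda>v. D v x)) (at x))"
  using assms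
proof induction
  case (const c)
  show ?case
    by (rule exI [of _ "\<lambda>v x. 0"]) (auto intro: smooth_algebra.intros)
next
  case (cis l)
  then show ?case
    by (intro exI [of _ "\<lambda>v x. \<i> * of_real (l v) * cis (l x)"] conjI allI
          has_derivative_cis' bounded_linear_imp_has_derivative smooth_algebra.intros)
next
  case (tanh l c)
  \<comment> \<open>Written with sums and products only, subtraction being addition of
    \<open>(- 1)\<close> times a term, so that the introduction rules of the algebra apply.\<close>
  define D where "D v x = (1 + (- 1) * (of_real (tanh (l x + c)) * of_real (tanh (l x + c)))) * complex_of_real (l v)"
    for v x
  have "((\<lambda>x. of_real (tanh (l x + c))) has_derivative (\<lambda>v. D v x)) (at x)" for x
    using has_derivative_of_real [OF has_derivative_tanh' [OF
        has_derivative_add_const [OF bounded_linear_imp_has_derivative [OF tanh], of c]], where 'a=complex]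
    by (simp add: D_def)
  moreover have "D v \<in> smooth_algebra" for v
    unfolding D_def using tanh by (intro smooth_algebra.intros)
  ultimately show ?case by blast
next
  case (sech l c)
  define D where "D v x = (- 1) * (of_real (tanh (l x + c)) * of_real (inverse (cosh (l x + c)))) * complex_of_real (l v)"
    for v x
  have "((\<lambda>x. of_real (inverse (cosh (l x + c)))) has_derivative (\<lambda>v. D v x)) (at x)" for x
    using has_derivative_of_real [OF has_derivative_sech [OF
        has_derivative_add_const [OF bounded_linear_imp_has_derivative [OF sech], of c]], where 'a=complex]
    by (simp add: D_def)
  moreover have "D v \<in> smooth_algebra" for v
    unfolding D_def using sech by (intro smooth_algebra.intros)
  ultimately show ?case by blast
next
  case (add f g)
  then obtain D E where "\<forall>v. D v \<in> smooth_algebra" "\<forall>x. (f has_derivative (\<lambda>v. D v x)) (at x)"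
    "\<forall>v. E v \<in> smooth_algebra" "\<forall>x. (g has_derivative (\<lambda>v. E v x)) (at x)"
    by blast
  then show ?case
    by (intro exI [of _ "\<lambda>v x. D v x + E v x"]) (auto intro: smooth_algebra.intros has_derivative_add)
next
  case (mult f g)
  then obtain D E where "\<forall>v. D v \<in> smooth_algebra" "\<forall>x. (f has_derivative (\<lambda>v. D v x)) (at x)"
    "\<forall>v. E v \<in> smooth_algebra" "\<forall>x. (g has_derivative (\<lambda>v. E v x)) (at x)"
    by blast
  with mult.hyps show ?case
    by (intro exI [of _ "\<lambda>v x. f x * E v x + D v x * g x"])
      (auto intro!: smooth_algebra.mult smooth_algebra.add has_derivative_mult)
qed

lemma bounded_linear_axis: "bounded_linear (axis k :: 'a::real_normed_vector \<Rightarrow> 'a ^ 'n)"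
proof (rule bounded_linear_intro [where K = 1])
  show "axis k (x + y) = axis k x + axis k (y::'a)" for x y by (simp add: vec_eq_iff axis_def)
  show "axis k (r *\<^sub>R x) = r *\<^sub>R axis k (x::'a)" for r x by (simp add: vec_eq_iff axis_def)
  show "norm (axis k (x::'a)) \<le> norm x * 1" for x by (simp add: norm_vec_def L2_set_def axis_def if_distrib if_distribR cong: if_cong)
qed

text \<open>Since \<open>axis k\<close> is bounded linear, it commutes with differentiation, so the
  image of the algebra under it is again closed under directional derivatives.\<close>

lemma smooth_on_axis_smooth_algebra:
  assumes "f \<in> smooth_algebra"
  shows "smooth_on UNIV (\<lambda>x. axis k (f x) :: complex ^ 'n)"
proof (rule smooth_on_UNIV_if_closed_derivatives [where F = "(\<lambda>f x. axis k (f x)) ` smooth_algebra"])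
  fix g :: "'a \<Rightarrow> complex ^ 'n" assume "g \<in> (\<lambda>f x. axis k (f x)) ` smooth_algebra"
  then obtain f where f: "f \<in> smooth_algebra" "g = (\<lambda>x. axis k (f x))" by auto
  then obtain D where "\<forall>v. D v \<in> smooth_algebra" "\<forall>x. (f has_derivative (\<lambda>v. D v x)) (at x)"
    using smooth_algebra_derivative by blast
  then show "\<exists>D. (\<forall>v. D v \<in> (\<lambda>f x. axis k (f x)) ` smooth_algebra) \<and>
      (\<forall>x. (g has_derivative (\<lambda>v. D v x)) (at x))"
    unfolding f(2)
    by (intro exI [of _ "\<lambda>v x. axis k (D v x)"])
      (auto intro: bounded_linear.has_derivative [OF bounded_linear_axis])
qed (use assms in auto)

section \<open>Plane waves\<close>

text \<open>The amplitude \<open>z\<close> is an argument so that derivatives, conjugation and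
  products become arithmetic on the pair of frequency and amplitude.\<close>

definition wave :: "'d \<Rightarrow> int \<Rightarrow> complex \<Rightarrow> real ^ 'd \<Rightarrow> complex"
  where "wave k m z x = z * cis (of_int m * x $ k)"

lemma pdv_wave:
  fixes k :: "'d::finite"
  shows "pdv j (wave k m z) = (if j = k then wave k m (\<i> * of_int m * z) else (\<lambda>x. 0))"
proof (rule ext)
  fix x :: "real ^ 'd"
  have D: "(wave k m z has_derivative
      (\<lambda>v. z * (\<i> * of_real (of_int m * v $ k) * cis (of_int m * x $ k)))) (at x)"
    unfolding wave_def [abs_def]
    by (intro has_derivative_mult_right has_derivative_cis' bounded_linear_imp_has_derivative
        bounded_linear_const_mult bounded_linear_vec_nth)
  show "pdv j (wave k m z) x = (if j = k then wave k m (\<i> * of_int m * z) else (\<lambda>x. 0)) x"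
    by (auto simp: pdv_def frechet_derivative_at [OF D, symmetric] wave_def axis_def)
qed

text \<open>An equation of functions rather than of values, so that it also rewrites the inner
  derivative in the Laplacian.\<close>

lemma pdv_axis_wave:
  fixes k :: "'d::finite"
  shows "pdv j (\<lambda>x. axis k (wave k m z x) :: complex ^ 'd) =
    (\<lambda>x. axis k (if j = k then wave k m (\<i> * of_int m * z) x else 0))"
proof (rule ext)
  fix x :: "real ^ 'd"
  have "((\<lambda>x. axis k (z * cis (of_int m * x $ k)) :: complex ^ 'd) has_derivative
      (\<lambda>v. axis k (z * (\<i> * of_real (of_int m * v $ k) * cis (of_int m * x $ k))))) (at x)"
    by (intro bounded_linear.has_derivative [OF bounded_linear_axis]
        has_derivative_mult_right has_derivative_cis' bounded_linear_imp_has_derivative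
        bounded_linear_const_mult bounded_linear_vec_nth)
  then show "pdv j (\<lambda>x. axis k (wave k m z x) :: complex ^ 'd) x =
    axis k (if j = k then wave k m (\<i> * of_int m * z) x else 0)"
    by (auto simp: pdv_def wave_def frechet_derivative_at [symmetric] axis_def vec_eq_iff)
qed

lemma pdv_const: "pdv j (\<lambda>x. c) = (\<lambda>x. 0)"
  by (simp add: pdv_def fun_eq_iff)

lemma laplacian_axis_wave:
  "laplacian (\<lambda>x. axis k (wave k m z x) :: complex ^ 'd) x = axis k (wave k m (- (of_int m)\<^sup>2 * z) x)"
proof -
  have "pdv j (pdv j (\<lambda>x. axis k (wave k m z x) :: complex ^ 'd)) x =
      (if j = k then axis k (wave k m (- (of_int m)\<^sup>2 * z) x) else 0)" for j
    unfolding pdv_axis_wave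
    by (cases "j = k") (simp_all add: pdv_axis_wave pdv_const axis_eq_0_iff power2_eq_square algebra_simps)
  then show ?thesis by (simp add: laplacian_def)
qed

lemma divergence_axis_wave:
  "divergence (\<lambda>x. axis k (wave k m z x) :: complex ^ 'd) x = wave k m (\<i> * of_int m * z) x"
proof -
  have "pdv j (\<lambda>y. axis k (wave k m z y) $ j) x =
      (if j = k then wave k m (\<i> * of_int m * z) x else 0)" for j
    by (cases "j = k") (simp_all add: axis_def pdv_const pdv_wave)
  then show ?thesis by (simp add: divergence_def)
qed

lemma gradient_wave: "gradient (wave k m z) x = axis k (wave k m (\<i> * of_int m * z) x)"
  by (auto simp: gradient_def vec_eq_iff pdv_wave axis_def)

section \<open>Conjugates, products and periodicity of plane waves\<close>

lemma cnj_wave: "cnj (wave k m z x) = wave k (- m) (cnj z) x"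
  by (simp add: wave_def cis_cnj)

lemma wave_mult: "wave k m z x * wave k n y x = wave k (m + n) (z * y) x"
  by (simp add: wave_def cis_mult algebra_simps flip: cis_mult)

lemma cnj_vec_axis: "cnj_vec (axis k z) = axis k (cnj z)"
  by (simp add: cnj_vec_def vec_eq_iff axis_def)

lemma cdot_axis: "cdot (axis k y) (axis k z) = y * z"
  by (simp add: cdot_def axis_def if_distrib cong: if_cong)

lemma torus_periodic_axis_wave: "torus_periodic (\<lambda>x. axis k (wave k m z x))"
proof -
  have "wave k m z (x + axis j (2 * pi)) = wave k m z x" for x j
  proof (cases "j = k")
    case True
    have "cis (of_int m * (2 * pi)) = 1" using cis_multiple_2pi [of "of_int m"] by (simp add: mult_ac)
    with True show ?thesis by (simp add: wave_def axis_def distrib_left flip: cis_mult)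
  qed (simp add: wave_def axis_def)
  then show ?thesis by (simp add: torus_periodic_def)
qed

lemma vector_derivative_axis_wave:
  assumes "(z has_vector_derivative z') (at t)"
  shows "vector_derivative (\<lambda>\<tau>. axis k (wave k m (z \<tau>) x) :: complex ^ 'd) (at t) = axis k (wave k m z' x)"
proof -
  have "((\<lambda>\<tau>. z \<tau> * cis (of_int m * x $ k)) has_vector_derivative z' * cis (of_int m * x $ k)) (at t)"
    using assms by (rule has_vector_derivative_mult_left)
  then show ?thesis
    unfolding wave_def
    by (intro vector_derivative_at bounded_linear.has_vector_derivative [OF bounded_linear_axis])
qed

section \<open>Fourier coefficients and Sobolev norms\<close>

text \<open>Lebesgue measure is the image of the product measure over \<open>Basis\<close> under the
  map from coordinates to vectors, so Fubini for finite products factors the integral.\<close>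

lemma integral_lborel_prod:
  fixes f :: "'a::euclidean_space \<Rightarrow> real \<Rightarrow> 'b::{real_normed_field,banach,second_countable_topology}"
  assumes f: "\<And>b. b \<in> Basis \<Longrightarrow> integrable lborel (f b)"
  shows "(\<integral>x. (\<Prod>b\<in>Basis. f b (x \<bullet> b)) \<partial>lborel) = (\<Prod>b\<in>Basis. \<integral>y. f b y \<partial>lborel)"
proof -
  interpret product_sigma_finite "\<lambda>_. lborel :: real measure" ..
  have [measurable]: "f b \<in> borel_measurable borel" if "b \<in> Basis" for b
    using f [OF that] by (auto dest: borel_measurable_integrable)
  have "(\<integral>x. (\<Prod>b\<in>Basis. f b (x \<bullet> b)) \<partial>(lborel :: 'a measure)) =
      (\<integral>g. (\<Prod>b\<in>Basis. f b ((\<Sum>c\<in>Basis. g c *\<^sub>R c) \<bullet> b)) \<partial>(\<Pi>\<^sub>M b\<in>(Basis::'a set). lborel))"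
    by (subst lborel_eq, rule integral_distr) measurable
  also have "\<dots> = (\<integral>g. (\<Prod>b\<in>Basis. f b (g b)) \<partial>(\<Pi>\<^sub>M b\<in>(Basis::'a set). lborel))"
    by (intro Bochner_Integration.integral_cong prod.cong refl) simp
  finally show ?thesis
    by (simp add: product_integral_prod f)
qed

lemma integral_cis_period:
  "(\<integral>y. indicator {0..2 * pi} y *\<^sub>R cis (of_int m * y) \<partial>lborel) = (if m = 0 then of_real (2 * pi) else 0)"
proof -
  have "((\<lambda>y. cis (of_int m * y)) has_integral (if m = 0 then of_real (2 * pi) else 0)) {0..2 * pi}"
  proof (cases "m = 0")
    case True
    then show ?thesis using has_integral_const_real [of "1::complex" 0 "2 * pi"]
      by (simp add: scaleR_conv_of_real)
  next
    case False
    \<comment> \<open>An antiderivative of the integrand; as \<open>m\<close> is an integer, it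
      takes the same value at both ends of the period.\<close>
    have "((\<lambda>y. cis (of_int m * y) / (\<i> * of_int m)) has_vector_derivative cis (of_int m * y))
        (at y within {0..2 * pi})" for y
      using False by (auto intro!: derivative_eq_intros simp: has_vector_derivative_def scaleR_conv_of_real fun_eq_iff)
        (simp add: mult_ac)
    from fundamental_theorem_of_calculus [OF _ this] False
    show ?thesis using cis_multiple_2pi [of "of_int m"] by (simp add: mult_ac)
  qed
  moreover have "set_integrable lborel {0..2 * pi} (\<lambda>y. cis (of_int m * y))"
    by (intro borel_integrable_atLeastAtMost' continuous_intros)
  ultimately show ?thesis
    using set_borel_integral_eq_integral(2) [of "{0..2 * pi}" "\<lambda>y. cis (of_int m * y)"]
    by (simp add: set_lebesgue_integral_def integral_unique)
qed

text \<open>The indicator of the box and the exponential of a sum are both products over the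
  coordinates, so the integral is a product of one-dimensional ones and vanishes as soon as one
  component of \<open>n\<close> is nonzero.\<close>

lemma integral_character:
  fixes n :: "int ^ 'd"
  shows "integral (cbox 0 (\<chi> j. 2 * pi)) (\<lambda>x::real ^ 'd. cis (\<Sum>j\<in>UNIV. of_int (n $ j) * x $ j)) =
    (if n = 0 then of_real ((2 * pi) ^ CARD('d)) else 0)"
proof -
  \<comment> \<open>The factors are indexed by basis vectors, as in the product formula over
    \<open>Basis\<close>; the inner product with \<open>b\<close> recovers the frequency
    component.\<close>
  define f where "f b y = indicator {0..2 * pi} y *\<^sub>R cis (((\<chi> j. of_int (n $ j)) \<bullet> b) * y)"
    for b :: "real ^ 'd" and y
  let ?C = "cbox 0 (\<chi> j. 2 * pi) :: (real ^ 'd) set"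
  have coord: "(\<chi> j. of_int (n $ j)) \<bullet> axis j (1::real) = of_int (n $ j)" for j
    by (simp add: inner_axis)
  have f_axis: "(\<integral>y. f (axis j 1) y \<partial>lborel) = (if n $ j = 0 then of_real (2 * pi) else 0)" for j
    by (simp only: f_def coord integral_cis_period)
  have Basis_image: "(Basis :: (real ^ 'd) set) = (\<lambda>j. axis j 1) ` UNIV"
    by (auto simp: Basis_vec_def)
  have inj: "inj (\<lambda>j. axis j 1 :: real ^ 'd)"
    by (auto simp: inj_def axis_eq_axis)
  have f_prod: "(\<Prod>b\<in>Basis. f b (x \<bullet> b)) =
      indicator ?C x *\<^sub>R cis (\<Sum>j\<in>UNIV. of_int (n $ j) * x $ j)" for x
  proof -
    have "(\<Prod>b\<in>Basis. f b (x \<bullet> b)) = (\<Prod>j\<in>UNIV. indicator {0..2 * pi} (x $ j) *\<^sub>R cis (of_int (n $ j) * x $ j))"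
      unfolding Basis_image f_def by (subst prod.reindex [OF inj]) (simp add: coord inner_axis)
    also have "\<dots> = (\<Prod>j\<in>UNIV. indicator {0..2 * pi} (x $ j)) * (\<Prod>j\<in>UNIV. cis (of_int (n $ j) * x $ j))"
      by (simp add: scaleR_conv_of_real prod.distrib of_real_indicator)
    also have "(\<Prod>j\<in>UNIV. cis (of_int (n $ j) * x $ j)) = cis (\<Sum>j\<in>UNIV. of_int (n $ j) * x $ j)"
      by (simp add: cis_conv_exp exp_sum sum_distrib_left)
    also have "(\<Prod>j\<in>UNIV. indicator {0..2 * pi} (x $ j)) = (indicator ?C x :: complex)"
      by (auto simp: indicator_def mem_box_cart)
    finally show ?thesis by (auto simp: indicator_def)
  qed
  have "integral ?C (\<lambda>x. cis (\<Sum>j\<in>UNIV. of_int (n $ j) * x $ j)) =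
      (\<integral>x. indicator ?C x *\<^sub>R cis (\<Sum>j\<in>UNIV. of_int (n $ j) * x $ j) \<partial>lborel)"
    using set_borel_integral_eq_integral(2) [of ?C "\<lambda>x. cis (\<Sum>j\<in>UNIV. of_int (n $ j) * x $ j)"]
    by (simp add: set_lebesgue_integral_def set_integrable_def borel_integrable_compact continuous_intros)
  also have "\<dots> = (\<integral>x. (\<Prod>b\<in>Basis. f b (x \<bullet> b)) \<partial>lborel)"
    by (simp add: f_prod)
  also have "\<dots> = (\<Prod>b\<in>Basis. \<integral>y. f b y \<partial>lborel)"
  proof (rule integral_lborel_prod)
    show "integrable lborel (f b)" for b
      using borel_integrable_atLeastAtMost' [of 0 "2 * pi" "\<lambda>y. cis (((\<chi> j. of_int (n $ j)) \<bullet> b) * y)"]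
      by (simp add: set_integrable_def f_def [abs_def] continuous_intros)
  qed
  also have "\<dots> = (\<Prod>j\<in>UNIV. if n $ j = 0 then of_real (2 * pi) else 0)"
    unfolding Basis_image by (subst prod.reindex [OF inj]) (simp add: f_axis)
  also have "\<dots> = (if n = 0 then of_real ((2 * pi) ^ CARD('d)) else 0)"
    by (auto simp: vec_eq_iff)
  finally show ?thesis .
qed

text \<open>Multiplication by the conjugate character turns the wave into a character of frequency
  \<open>axis k m - n\<close>, to which orthogonality applies.\<close>

lemma fourier_coeff_wave:
  fixes k :: "'d::finite"
  shows "fourier_coeff (wave k m z) n = (if n = axis k m then z else 0)"
proof -
  have "wave k m z x * cis (- (\<Sum>j\<in>UNIV. of_int (n $ j) * x $ j)) =
      z * cis (\<Sum>j\<in>UNIV. of_int ((axis k m - n) $ j) * x $ j)" for x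
  proof -
    have "(\<Sum>j\<in>UNIV. of_int ((axis k m - n) $ j) * x $ j) =
        (\<Sum>j\<in>UNIV. if j = k then of_int m * x $ k else 0) - (\<Sum>j\<in>UNIV. of_int (n $ j) * x $ j)"
      unfolding sum_subtractf [symmetric]
      by (intro sum.cong) (auto simp: axis_def algebra_simps)
    then show ?thesis by (simp add: wave_def mult.assoc cis_mult)
  qed
  then have "fourier_coeff (wave k m z) n =
      z * (if axis k m - n = 0 then of_real ((2 * pi) ^ CARD('d)) else 0) / of_real ((2 * pi) ^ CARD('d))"
    by (simp only: fourier_coeff_def integral_mult_right integral_character)
  then show ?thesis by auto
qed

lemma sobolev_norm_wave_squared:
  "(sobolev_norm s (wave k m z))\<^sup>2 = (1 + (of_int m)\<^sup>2) powr s * (cmod z)\<^sup>2"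
proof -
  let ?f = "\<lambda>n::int ^ 'a. (1 + (\<Sum>j\<in>UNIV. (of_int (n $ j))\<^sup>2)) powr s * (cmod (fourier_coeff (wave k m z) n))\<^sup>2"
  have "(\<Sum>j\<in>UNIV. (of_int (axis k m $ j))\<^sup>2) = (\<Sum>j\<in>UNIV. if j = k then (of_int m)\<^sup>2 else (0::real))"
    by (intro sum.cong) (auto simp: axis_def)
  then have "?f (axis k m) = (1 + (of_int m)\<^sup>2) powr s * (cmod z)\<^sup>2"
    by (simp add: fourier_coeff_wave)
  \<comment> \<open>All other coefficients vanish, so the infinite sum collapses to one point for
    every real \<open>s\<close>.\<close>
  moreover have "infsum ?f UNIV = infsum ?f {axis k m}"
    by (rule infsum_cong_neutral) (auto simp: fourier_coeff_wave)
  ultimately show ?thesis by (simp add: sobolev_norm_def)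
qed

lemma sobolev_norm_zero: "sobolev_norm s (\<lambda>x. 0) = 0"
  by (simp add: sobolev_norm_def fourier_coeff_def)

lemma Hs_norm_axis_wave:
  "Hs_norm s (\<lambda>x. axis k (wave k m1 z1 x), \<lambda>x. axis k (wave k m2 z2 x), \<lambda>x. axis k (wave k m3 z3 x)) =
    sqrt ((1 + (of_int m1)\<^sup>2) powr s * (cmod z1)\<^sup>2 + (1 + (of_int m2)\<^sup>2) powr s * (cmod z2)\<^sup>2
        + (1 + (of_int m3)\<^sup>2) powr s * (cmod z3)\<^sup>2)"
proof -
  have "(sobolev_norm s (\<lambda>x. axis k (wave k m z x) $ j))\<^sup>2 =
      (if j = k then (1 + (of_int m)\<^sup>2) powr s * (cmod z)\<^sup>2 else 0)" for m z j
    by (cases "j = k") (simp_all add: axis_def sobolev_norm_zero sobolev_norm_wave_squared)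
  then show ?thesis by (simp add: Hs_norm_def sum.distrib)
qed

section \<open>Resonant solutions\<close>

text \<open>The \<open>cis\<close> factor is the free Schroedinger phase for dispersion \<kappa> and
  frequency \<open>m\<close>; \<open>h\<close> is the amplitude in the interaction picture, constant
  for a free wave.\<close>

definition modulated_wave :: "'d \<Rightarrow> real \<Rightarrow> int \<Rightarrow> (real \<Rightarrow> real) \<Rightarrow> real \<Rightarrow> real ^ 'd \<Rightarrow> complex ^ 'd"
  where "modulated_wave k \<kappa> m h t =
    (\<lambda>x. axis k (wave k m (of_real (h t) * cis (- \<kappa> * (of_int m)\<^sup>2 * t)) x))"

text \<open>Differentiating the free phase produces exactly the negative of the Laplacian term, so
  only the derivative of the amplitude survives.\<close>

lemma vector_derivative_modulated_wave:
  assumes "(h has_real_derivative h') (at t)"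
  shows "\<i> *s vector_derivative (\<lambda>\<tau>. modulated_wave k \<kappa> m h \<tau> x) (at t)
      + \<kappa> *\<^sub>R laplacian (modulated_wave k \<kappa> m h t) x
    = axis k (wave k m (\<i> * of_real h' * cis (- \<kappa> * (of_int m)\<^sup>2 * t)) x)"
proof -
  let ?c = "\<lambda>t. cis (- \<kappa> * (of_int m)\<^sup>2 * t)"
  have "((\<lambda>t. of_real (h t) * ?c t) has_derivative
      (\<lambda>v. of_real (h t) * (\<i> * of_real (- \<kappa> * (of_int m)\<^sup>2 * v) * ?c t) + of_real (h' * v) * ?c t)) (at t)"
    using assms unfolding has_field_derivative_def
    by (intro has_derivative_mult has_derivative_of_real has_derivative_cis'
        bounded_linear_imp_has_derivative bounded_linear_mult_right)
  then have "((\<lambda>t. of_real (h t) * ?c t) has_vector_derivative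
      (of_real h' - \<i> * of_real (\<kappa> * (of_int m)\<^sup>2 * h t)) * ?c t) (at t)"
    by (simp add: has_vector_derivative_def scaleR_conv_of_real algebra_simps)
  note vd = vector_derivative_axis_wave [OF this, of k m x]
  have [simp]: "\<i> *s axis k z = axis k (\<i> * z)" "\<kappa> *\<^sub>R axis k z = axis k (of_real \<kappa> * z)"
    "axis k z + axis k z' = axis k (z + z')" for z z' :: complex
    by (simp_all add: vec_eq_iff axis_def) (simp add: scaleR_conv_of_real)
  show ?thesis
    unfolding modulated_wave_def laplacian_axis_wave vd by (simp add: wave_def algebra_simps)
qed

lemma smooth_on_modulated_wave:
  assumes h: "(\<lambda>p. of_real (h (fst p))) \<in> (smooth_algebra :: (real \<times> (real ^ 'd) \<Rightarrow> complex) set)"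
  shows "smooth_on UNIV (\<lambda>(t, x :: real ^ 'd). modulated_wave k \<kappa> m h t x)"
proof -
  have "(\<lambda>p. of_real (h (fst p)) * cis (- \<kappa> * (of_int m)\<^sup>2 * fst p) * cis (of_int m * snd p $ k))
      \<in> (smooth_algebra :: (real \<times> (real ^ 'd) \<Rightarrow> complex) set)"
    by (intro smooth_algebra.mult smooth_algebra.cis h bounded_linear_const_mult bounded_linear_fst
        bounded_linear_compose [OF bounded_linear_vec_nth bounded_linear_snd])
  from smooth_on_axis_smooth_algebra [OF this, of k]
  show ?thesis by (simp add: modulated_wave_def wave_def case_prod_unfold)
qed

text \<open>In each equation both sides have the same spatial frequency, the resonance makes their
  time phases agree, and the amplitude equations match what is left. The equations for
  \<open>v\<close> and \<open>w\<close> both reduce to b' = (m1 - m2) a b, which is why one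
  \<open>b\<close> serves for both.\<close>

lemma classical_solution_resonant:
  fixes k :: "'d::finite" and a b :: "real \<Rightarrow> real"
  assumes resonance: "\<alpha> * (of_int m1)\<^sup>2 = \<beta> * (of_int m2)\<^sup>2 + \<gamma> * (of_int (m1 - m2))\<^sup>2"
    and a: "\<And>t. (a has_real_derivative - (of_int (m1 - m2) * (b t)\<^sup>2)) (at t)"
    and b: "\<And>t. (b has_real_derivative of_int (m1 - m2) * a t * b t) (at t)"
    and smooth: "(\<lambda>p. of_real (a (fst p))) \<in> (smooth_algebra :: (real \<times> (real ^ 'd) \<Rightarrow> complex) set)"
      "(\<lambda>p. of_real (b (fst p))) \<in> (smooth_algebra :: (real \<times> (real ^ 'd) \<Rightarrow> complex) set)"
  shows "classical_solution \<alpha> \<beta> \<gamma> UNIV (modulated_wave k \<alpha> m1 a) (modulated_wave k \<beta> m2 b)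
    (modulated_wave k \<gamma> (m1 - m2) b)"
proof -
  have phase: "cis (- \<alpha> * (of_int m1)\<^sup>2 * t) =
      cis (- \<beta> * (of_int m2)\<^sup>2 * t) * cis (- \<gamma> * (of_int (m1 - m2))\<^sup>2 * t)" for t
  proof -
    have "- \<alpha> * (of_int m1)\<^sup>2 * t = - \<beta> * (of_int m2)\<^sup>2 * t + - \<gamma> * (of_int (m1 - m2))\<^sup>2 * t"
      using arg_cong [OF resonance, of "\<lambda>r. - r * t"] by (simp add: algebra_simps)
    then show ?thesis by (simp add: cis_mult)
  qed
  have smul: "c *s axis k z = axis k (c * z)" for c z :: complex
    by (simp add: vec_eq_iff axis_def)
  have neg: "- axis k z = axis k (- z)" for z :: complex
    by (simp add: vec_eq_iff axis_def)
  let ?u = "modulated_wave k \<alpha> m1 a" and ?v = "modulated_wave k \<beta> m2 b"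
    and ?w = "modulated_wave k \<gamma> (m1 - m2) b"
  \<comment> \<open>Folding the phases into an opaque symbol leaves the simplifier with the two
    multiplicative facts below: the resonance and modulus one.\<close>
  define E where "E \<kappa> m t = cis (- \<kappa> * (of_int m)\<^sup>2 * t)" for \<kappa> t :: real and m :: int
  have E: "E \<alpha> m1 t = E \<beta> m2 t * E \<gamma> (m1 - m2) t" "E \<kappa> m t * cnj (E \<kappa> m t) = 1"
    for \<kappa> t :: real and m :: int
    using phase by (simp_all add: E_def cis_cnj cis_mult)
  have "\<i> *s vector_derivative (\<lambda>\<tau>. ?u \<tau> x) (at t) + \<alpha> *\<^sub>R laplacian (?u t) x
      = - (divergence (?w t) x *s ?v t x)" for t x
    unfolding vector_derivative_modulated_wave [OF a] unfolding modulated_wave_def E_def [symmetric]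
    by (simp add: divergence_axis_wave smul neg wave_mult)
      (simp add: wave_def E power2_eq_square algebra_simps)
  moreover have "\<i> *s vector_derivative (\<lambda>\<tau>. ?v \<tau> x) (at t) + \<beta> *\<^sub>R laplacian (?v t) x
      = - (divergence (\<lambda>y. cnj_vec (?w t y)) x *s ?u t x)" for t x
  proof -
    \<comment> \<open>The phase relation is solved for another factor by multiplying with a
      conjugate of modulus one; the equation for \<open>w\<close> below does the same.\<close>
    have "E \<beta> m2 t = cnj (E \<gamma> (m1 - m2) t) * E \<alpha> m1 t"
      using E(2) [of \<gamma> "m1 - m2" t] by (simp add: E(1) mult_ac)
    then show ?thesis
      unfolding vector_derivative_modulated_wave [OF b] unfolding modulated_wave_def E_def [symmetric]
      by (simp add: cnj_vec_axis cnj_wave divergence_axis_wave smul neg wave_mult)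
        (simp add: wave_def algebra_simps)
  qed
  moreover have "\<i> *s vector_derivative (\<lambda>\<tau>. ?w \<tau> x) (at t) + \<gamma> *\<^sub>R laplacian (?w t) x
      = gradient (\<lambda>y. cdot (?u t y) (cnj_vec (?v t y))) x" for t x
  proof -
    have "E \<gamma> (m1 - m2) t = E \<alpha> m1 t * cnj (E \<beta> m2 t)"
      using E(2) [of \<beta> m2 t] by (simp add: E(1) mult_ac)
    then show ?thesis
      unfolding vector_derivative_modulated_wave [OF b] unfolding modulated_wave_def E_def [symmetric]
      by (simp add: cnj_vec_axis cnj_wave cdot_axis gradient_wave wave_mult)
        (simp add: wave_def algebra_simps)
  qed
  moreover have "torus_periodic (modulated_wave k \<kappa> m h t)" for \<kappa> m h t
    by (simp add: modulated_wave_def torus_periodic_axis_wave)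
  ultimately show ?thesis
    by (simp add: classical_solution_def smooth_on_modulated_wave smooth)
qed

section \<open>Explicit solutions of the amplitude equations\<close>

definition kink :: "real \<Rightarrow> real \<Rightarrow> real \<Rightarrow> real \<Rightarrow> real"
  where "kink R q t\<^sub>0 t = - R * tanh (q * (t - t\<^sub>0))"

text \<open>With \<open>kink\<close> it traces the circle a^2 + b^2 = R^2 between the equilibria (R,
  0) and (-R, 0). The amplitude equations hold when the rate argument is \<open>q * R\<close> with
  \<open>q\<close> the frequency difference; at time \<open>t\<^sub>0\<close> everything sits in
  \<open>v\<close> and \<open>w\<close>.\<close>

definition soliton :: "real \<Rightarrow> real \<Rightarrow> real \<Rightarrow> real \<Rightarrow> real"
  where "soliton R q t\<^sub>0 t = R * inverse (cosh (q * (t - t\<^sub>0)))"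

lemma kink_has_derivative:
  "(kink R (q * R) t\<^sub>0 has_real_derivative - (q * (soliton R (q * R) t\<^sub>0 t)\<^sup>2)) (at t)"
proof -
  have "1 - (tanh (q * R * (t - t\<^sub>0)))\<^sup>2 = (inverse (cosh (q * R * (t - t\<^sub>0))))\<^sup>2"
    using cosh_real_nonzero [of "q * R * (t - t\<^sub>0)"]
    by (simp add: tanh_def divide_simps) (simp add: cosh_square_eq)
  then show ?thesis
    unfolding kink_def [abs_def] soliton_def
    by (auto intro!: derivative_eq_intros simp: power2_eq_square)
qed

lemma soliton_has_derivative:
  "(soliton R (q * R) t\<^sub>0 has_real_derivative q * kink R (q * R) t\<^sub>0 t * soliton R (q * R) t\<^sub>0 t) (at t)"
  unfolding kink_def soliton_def [abs_def]
  by (auto intro!: derivative_eq_intros simp: tanh_def divide_simps)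

lemma kink_soliton_smooth:
  "(\<lambda>p. of_real (kink R q t\<^sub>0 (fst p))) \<in> (smooth_algebra :: (real \<times> (real ^ 'd) \<Rightarrow> complex) set)"
  "(\<lambda>p. of_real (soliton R q t\<^sub>0 (fst p))) \<in> (smooth_algebra :: (real \<times> (real ^ 'd) \<Rightarrow> complex) set)"
proof -
  have l: "bounded_linear (\<lambda>p :: real \<times> (real ^ 'd). q * fst p)"
    by (intro bounded_linear_const_mult bounded_linear_fst)
  \<comment> \<open>The argument is expanded into a linear form plus a constant, which is the shape
    of the generators.\<close>
  have "(\<lambda>p. of_real (- R) * of_real (tanh (q * fst p + (- q * t\<^sub>0))))
      \<in> (smooth_algebra :: (real \<times> (real ^ 'd) \<Rightarrow> complex) set)"
    by (intro smooth_algebra.mult smooth_algebra.const smooth_algebra.tanh l)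
  then show "(\<lambda>p. of_real (kink R q t\<^sub>0 (fst p))) \<in> (smooth_algebra :: (real \<times> (real ^ 'd) \<Rightarrow> complex) set)"
    by (simp add: kink_def right_diff_distrib)
  have "(\<lambda>p. of_real R * of_real (inverse (cosh (q * fst p + (- q * t\<^sub>0)))))
      \<in> (smooth_algebra :: (real \<times> (real ^ 'd) \<Rightarrow> complex) set)"
    by (intro smooth_algebra.mult smooth_algebra.const smooth_algebra.sech l)
  then show "(\<lambda>p. of_real (soliton R q t\<^sub>0 (fst p))) \<in> (smooth_algebra :: (real \<times> (real ^ 'd) \<Rightarrow> complex) set)"
    by (simp add: soliton_def right_diff_distrib)
qed

section \<open>The squared norm as a function of the rescaled time \<theta>\<close>

definition energy :: "real \<Rightarrow> int \<Rightarrow> int \<Rightarrow> real \<Rightarrow> real \<Rightarrow> real"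
  where "energy s m1 m2 R \<theta> = (1 + (of_int m1)\<^sup>2) powr s * (R * tanh \<theta>)\<^sup>2
    + ((1 + (of_int m2)\<^sup>2) powr s + (1 + (of_int (m1 - m2))\<^sup>2) powr s) * (R / cosh \<theta>)\<^sup>2"

text \<open>The free phases have modulus one, so the norm sees only the amplitudes, and time enters
  through \<theta> alone.\<close>

lemma Hs_norm_modulated_waves:
  "Hs_norm s (modulated_wave k \<alpha> m1 (kink R q t\<^sub>0) t, modulated_wave k \<beta> m2 (soliton R q t\<^sub>0) t,
     modulated_wave k \<gamma> (m1 - m2) (soliton R q t\<^sub>0) t) = sqrt (energy s m1 m2 R (q * (t - t\<^sub>0)))"
  unfolding modulated_wave_def Hs_norm_axis_wave
  by (simp add: energy_def kink_def soliton_def norm_mult divide_inverse distrib_right del: of_real_mult)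

text \<open>Reduces the theorem to real asymptotics: what is left to choose are the frequencies, the
  amplitude \<open>R\<close>, the centre \<open>t\<^sub>0\<close> and the final time
  \<open>T\<close>.\<close>

lemma norm_inflation_if_energy_inflation:
  fixes \<mu> \<nu> :: "nat \<Rightarrow> int" and R t\<^sub>0 T :: "nat \<Rightarrow> real"
  assumes resonance: "\<And>n. \<alpha> * (of_int (\<mu> n))\<^sup>2 = \<beta> * (of_int (\<nu> n))\<^sup>2 + \<gamma> * (of_int (\<mu> n - \<nu> n))\<^sup>2"
    and T: "\<And>n. T n > 0" "T \<longlonglongrightarrow> 0"
    and initial: "(\<lambda>n. energy s (\<mu> n) (\<nu> n) (R n) (of_int (\<mu> n - \<nu> n) * R n * (0 - t\<^sub>0 n))) \<longlonglongrightarrow> 0"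
    and final: "filterlim (\<lambda>n. energy s (\<mu> n) (\<nu> n) (R n) (of_int (\<mu> n - \<nu> n) * R n * (T n - t\<^sub>0 n)))
      at_top sequentially"
  shows "\<exists>(u :: nat \<Rightarrow> real \<Rightarrow> real ^ 'd \<Rightarrow> complex ^ 'd)
          (v :: nat \<Rightarrow> real \<Rightarrow> real ^ 'd \<Rightarrow> complex ^ 'd)
          (w :: nat \<Rightarrow> real \<Rightarrow> real ^ 'd \<Rightarrow> complex ^ 'd)
          (t :: nat \<Rightarrow> real).
    (\<forall>n. t n > 0 \<and>
         (\<exists>I. is_interval I \<and> {0..t n} \<subseteq> I \<and> classical_solution \<alpha> \<beta> \<gamma> I (u n) (v n) (w n))) \<and>
    t \<longlonglongrightarrow> 0 \<and>
    (\<lambda>n. Hs_norm s (u n 0, v n 0, w n 0)) \<longlonglongrightarrow> 0 \<and>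
    filterlim (\<lambda>n. Hs_norm s (u n (t n), v n (t n), w n (t n))) at_top sequentially"
proof -
  \<comment> \<open>Any coordinate direction will do.\<close>
  define k :: 'd where "k = undefined"
  define a where "a n = kink (R n) (of_int (\<mu> n - \<nu> n) * R n) (t\<^sub>0 n)" for n
  define b where "b n = soliton (R n) (of_int (\<mu> n - \<nu> n) * R n) (t\<^sub>0 n)" for n
  define u where "u n = modulated_wave k \<alpha> (\<mu> n) (a n)" for n
  define v where "v n = modulated_wave k \<beta> (\<nu> n) (b n)" for n
  define w where "w n = modulated_wave k \<gamma> (\<mu> n - \<nu> n) (b n)" for n
  have norm: "Hs_norm s (u n t, v n t, w n t) =
      sqrt (energy s (\<mu> n) (\<nu> n) (R n) (of_int (\<mu> n - \<nu> n) * R n * (t - t\<^sub>0 n)))" for n t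
    unfolding u_def v_def w_def a_def b_def by (rule Hs_norm_modulated_waves)
  have "classical_solution \<alpha> \<beta> \<gamma> UNIV (u n) (v n) (w n)" for n
    unfolding u_def v_def w_def a_def b_def
    by (intro classical_solution_resonant resonance kink_has_derivative soliton_has_derivative
        kink_soliton_smooth)
  \<comment> \<open>The solutions are global, so the time interval is the whole line.\<close>
  then have "\<forall>n. T n > 0 \<and>
      (\<exists>I. is_interval I \<and> {0..T n} \<subseteq> I \<and> classical_solution \<alpha> \<beta> \<gamma> I (u n) (v n) (w n))"
    using T(1) is_interval_univ by blast
  moreover have "(\<lambda>n. Hs_norm s (u n 0, v n 0, w n 0)) \<longlonglongrightarrow> 0"
    unfolding norm using tendsto_real_sqrt [OF initial] by simp
  moreover have "filterlim (\<lambda>n. Hs_norm s (u n (T n), v n (T n), w n (T n))) at_top sequentially"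
    unfolding norm by (rule filterlim_compose [OF sqrt_at_top final])
  ultimately show ?thesis using T(2) by blast
qed

section \<open>Norm inflation\<close>

text \<open>Uses |tanh| \<le> 1 and cosh \<theta> \<ge> exp (- \<theta>) / 2. It is meant for very
  negative \<theta>, where nearly all the amplitude is in \<open>u\<close> and the other two waves
  are exponentially small.\<close>

lemma energy_le:
  "energy s m1 m2 R \<theta> \<le> (1 + (of_int m1)\<^sup>2) powr s * R\<^sup>2
    + ((1 + (of_int m2)\<^sup>2) powr s + (1 + (of_int (m1 - m2))\<^sup>2) powr s) * (2 * R * exp \<theta>)\<^sup>2"
proof -
  have "\<bar>tanh \<theta>\<bar> \<le> 1"
    using tanh_real_bounds [of \<theta>] by auto
  then have "(R * tanh \<theta>)\<^sup>2 \<le> R\<^sup>2"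
    by (simp add: power_mult_distrib abs_square_le_1 mult_left_le)
  moreover have "inverse (cosh \<theta>) \<le> 2 * exp \<theta>"
  proof -
    have "exp (- \<theta>) / 2 \<le> cosh \<theta>" by (simp add: cosh_def)
    then have "inverse (cosh \<theta>) \<le> inverse (exp (- \<theta>) / 2)"
      by (intro le_imp_inverse_le) auto
    also have "inverse (exp (- \<theta>) / 2) = 2 * exp \<theta>"
      by (simp add: exp_minus field_simps)
    finally show ?thesis .
  qed
  then have "(inverse (cosh \<theta>))\<^sup>2 \<le> (2 * exp \<theta>)\<^sup>2"
    by (intro power_mono) simp_all
  then have "R\<^sup>2 * (inverse (cosh \<theta>))\<^sup>2 \<le> R\<^sup>2 * (2 * exp \<theta>)\<^sup>2"
    by (intro mult_left_mono) simp_all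
  then have "(R / cosh \<theta>)\<^sup>2 \<le> (2 * R * exp \<theta>)\<^sup>2"
    by (simp add: power_mult_distrib divide_inverse mult_ac)
  ultimately show ?thesis
    unfolding energy_def by (intro add_mono mult_left_mono) simp_all
qed

lemma energy_nonneg: "0 \<le> energy s m1 m2 R \<theta>"
  by (simp add: energy_def)

text \<open>The contribution of \<open>u\<close> alone, enough for growth when \<open>u\<close> ends
  up carrying the large norm.\<close>

lemma energy_ge: "(1 + (of_int m1)\<^sup>2) powr s * (R * tanh \<theta>)\<^sup>2 \<le> energy s m1 m2 R \<theta>"
  by (simp add: energy_def)

lemma energy_0:
  "energy s m1 m2 R 0 = ((1 + (of_int m2)\<^sup>2) powr s + (1 + (of_int (m1 - m2))\<^sup>2) powr s) * R\<^sup>2"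
  by (simp add: energy_def)

theorem theorem1p9:
  fixes \<alpha> \<beta> \<gamma> s :: real
  assumes "\<alpha> \<noteq> 0" and "\<beta> \<noteq> 0" and "\<gamma> \<noteq> 0"
    and "(\<beta> + \<gamma> = 0 \<and> s \<noteq> 0) \<or> (\<alpha> - \<gamma> = 0 \<and> s < 0)"
  shows "\<exists>(u :: nat \<Rightarrow> real \<Rightarrow> real ^ 'd \<Rightarrow> complex ^ 'd)
          (v :: nat \<Rightarrow> real \<Rightarrow> real ^ 'd \<Rightarrow> complex ^ 'd)
          (w :: nat \<Rightarrow> real \<Rightarrow> real ^ 'd \<Rightarrow> complex ^ 'd)
          (t :: nat \<Rightarrow> real).
    (\<forall>n. t n > 0 \<and>
         (\<exists>I. is_interval I \<and> {0..t n} \<subseteq> I \<and> classical_solution \<alpha> \<beta> \<gamma> I (u n) (v n) (w n))) \<and>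
    t \<longlonglongrightarrow> 0 \<and>
    (\<lambda>n. Hs_norm s (u n 0, v n 0, w n 0)) \<longlonglongrightarrow> 0 \<and>
    filterlim (\<lambda>n. Hs_norm s (u n (t n), v n (t n), w n (t n))) at_top sequentially"
proof -
  \<comment> \<open>\<open>M n\<close> is the base of the Sobolev weight at the frequency
    \<open>N n\<close> = 1 + n, which is never 0.\<close>
  define M where "M n = 1 + (1 + real n)\<^sup>2" for n
  have M: "M n > 0" for n
    by (simp add: M_def add_pos_nonneg)
  define N where "N n = 1 + int n" for n
  have N: "of_int (N n) = 1 + real n" for n
    by (simp add: N_def)
  have energy_opp_0: "energy s 0 (- j) r 0 = 2 * (1 + (of_int j)\<^sup>2) powr s * r\<^sup>2" for j r
    by (simp add: energy_0)
  have energy_opp_le: "energy s 0 (- j) r \<theta> \<le> r\<^sup>2 + 2 * (1 + (of_int j)\<^sup>2) powr s * (2 * r * exp \<theta>)\<^sup>2" for j r \<theta>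
    using energy_le [of s 0 "- j" r \<theta>] by simp
  have resonance: "\<alpha> * (of_int 0)\<^sup>2 = \<beta> * (of_int (- j))\<^sup>2 + \<gamma> * (of_int (0 - - j))\<^sup>2"
    if "\<beta> + \<gamma> = 0" for j :: int
    using that by (simp flip: distrib_right)
  consider (i_neg) "\<beta> + \<gamma> = 0" "s < 0" | (i_pos) "\<beta> + \<gamma> = 0" "s > 0" | (ii) "\<alpha> = \<gamma>" "s < 0"
    using assms(4) by fastforce
  then show ?thesis
  proof cases
    case i_neg
    \<comment> \<open>Start at \<theta> = 0 with everything at frequencies \<open>- N n\<close> and
      \<open>N n\<close>: the squared norm is 2 M^s R^2 = 2 M^(s/2), which tends to 0 although
      \<open>R\<close> tends to infinity. \<open>T\<close> is the time at which \<theta> = 1, when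
      \<open>u\<close> has amplitude of size R tanh 1 at frequency 0, of weight 1.\<close>
    define R where "R n = M n powr (- s / 4)" for n
    define T where "T n = 1 / ((1 + real n) * R n)" for n
    have R: "R n > 0" for n using M [of n] by (simp add: R_def)
    have phase: "(1 + real n) * (R n * T n) = 1" for n
      using R [of n] by (simp add: T_def divide_simps)
    show ?thesis
    proof (rule norm_inflation_if_energy_inflation [where \<mu> = "\<lambda>_. 0" and \<nu> = "\<lambda>n. - N n"
          and R = R and t\<^sub>0 = "\<lambda>_. 0" and T = T])
      show "\<alpha> * (of_int 0)\<^sup>2 = \<beta> * (of_int (- N n))\<^sup>2 + \<gamma> * (of_int (0 - - N n))\<^sup>2" for n
        using i_neg(1) by (rule resonance)
      show "T n > 0" for n by (simp add: T_def R)
      show "T \<longlonglongrightarrow> 0"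
        unfolding T_def [abs_def] R_def M_def using i_neg(2) by real_asymp
      have "(\<lambda>n. 2 * ((1 + (1 + real n)\<^sup>2) powr s * ((1 + (1 + real n)\<^sup>2) powr (- s / 4))\<^sup>2)) \<longlonglongrightarrow> 0"
        using i_neg(2) by real_asymp
      then show "(\<lambda>n. energy s 0 (- N n) (R n) (of_int (0 - - N n) * R n * (0 - 0))) \<longlonglongrightarrow> 0"
        by (simp add: energy_opp_0 N R_def M_def mult.assoc)
      \<comment> \<open>The constant \<open>tanh 1\<close> is abstracted to \<open>c\<close>, of
        which only positivity matters.\<close>
      have "filterlim (\<lambda>n. (R n * c)\<^sup>2) at_top sequentially" if "c > 0" for c
        unfolding R_def M_def using i_neg(2) that by real_asymp
      from this [of "tanh 1"] have "filterlim (\<lambda>n. (R n * tanh 1)\<^sup>2) at_top sequentially"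
        by simp
      then show "filterlim (\<lambda>n. energy s 0 (- N n) (R n) (of_int (0 - - N n) * R n * (T n - 0)))
          at_top sequentially"
        by (rule filterlim_at_top_mono)
          (use energy_ge [of 0 s _ 1] in \<open>simp add: mult.assoc N phase\<close>)
    qed
  next
    case i_pos
    \<comment> \<open>With N = 1 + n and R = N^(-e), the bound e < s makes the final squared norm,
      of order N^(2s - 2e), blow up, and e \<le> 1/2 makes T = N^(e - 3/4) tend to 0.\<close>
    define e where "e = min s 1 / 2"
    have e: "e > 0" "e < s" "e \<le> 1 / 2" using i_pos(2) by (auto simp: e_def)
    define R where "R n = (1 + real n) powr (- e)" for n
    \<comment> \<open>The transfer now runs backwards, from \<open>u\<close> at frequency 0 to
      \<open>v\<close> and \<open>w\<close>, so the centre is the final time. The initial \<theta>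
      is - N^(1/4): slow enough for \<open>T\<close> to vanish, yet negative enough for an
      exponential gain.\<close>
    define T where "T n = (1 + real n) powr (1 / 4) / ((1 + real n) * R n)" for n
    have R: "R n > 0" for n by (simp add: R_def)
    have phase: "(1 + real n) * (R n * T n) = (1 + real n) powr (1 / 4)" for n
      using R [of n] by (simp add: T_def divide_simps)
    show ?thesis
    proof (rule norm_inflation_if_energy_inflation [where \<mu> = "\<lambda>_. 0" and \<nu> = "\<lambda>n. - N n"
          and R = R and t\<^sub>0 = T and T = T])
      show "\<alpha> * (of_int 0)\<^sup>2 = \<beta> * (of_int (- N n))\<^sup>2 + \<gamma> * (of_int (0 - - N n))\<^sup>2" for n
        using i_pos(1) by (rule resonance)
      show "T n > 0" for n by (simp add: T_def R)
      have "T = (\<lambda>n. (1 + real n) powr (1 / 4 - (1 + - e)))"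
        unfolding T_def [abs_def] R_def powr_diff powr_add by simp
      moreover have "(\<lambda>n. (1 + real n) powr (1 / 4 - (1 + - e))) \<longlonglongrightarrow> 0"
        using e by real_asymp
      ultimately show "T \<longlonglongrightarrow> 0" by simp
      \<comment> \<open>The exponential factor beats the growing weight M^s of the high frequencies;
        the energy is then squeezed between 0 and this bound.\<close>
      have "(\<lambda>n. (R n)\<^sup>2 + 2 * M n powr s * (2 * R n * exp (- ((1 + real n) powr (1 / 4))))\<^sup>2) \<longlonglongrightarrow> 0"
        unfolding R_def M_def using e i_pos(2) by real_asymp
      then show "(\<lambda>n. energy s 0 (- N n) (R n) (of_int (0 - - N n) * R n * (0 - T n))) \<longlonglongrightarrow> 0"
        by (rule tendsto_sandwich [OF _ _ tendsto_const, rotated -1])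
          (use energy_nonneg energy_opp_le [of "N _"] in \<open>simp_all add: mult.assoc phase N M_def\<close>)
      have "filterlim (\<lambda>n. 2 * M n powr s * (R n)\<^sup>2) at_top sequentially"
        unfolding R_def M_def using e i_pos(2) by real_asymp
      then show "filterlim (\<lambda>n. energy s 0 (- N n) (R n) (of_int (0 - - N n) * R n * (T n - T n)))
          at_top sequentially"
        by (simp add: energy_opp_0 N M_def)
    qed
  next
    case ii
    \<comment> \<open>Here \<open>u\<close> and \<open>w\<close> have frequency \<open>N n\<close>
      and \<open>v\<close> has frequency 0. Initially \<theta> = - N, so \<open>u\<close> dominates
      with squared norm about M^s R^2 = M^(s/2), and the part in \<open>v\<close> is exponentially
      small. At \<open>T\<close>, \<theta> = 0 and \<open>v\<close> has amplitude \<open>R\<close>,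
      which tends to infinity, at weight 1.\<close>
    define R where "R n = M n powr (- s / 4)" for n
    define T where "T n = 1 / R n" for n
    have R: "R n > 0" for n using M [of n] by (simp add: R_def)
    have phase: "R n * T n = 1" for n
      using R [of n] by (simp add: T_def)
    show ?thesis
    proof (rule norm_inflation_if_energy_inflation [where \<mu> = N and \<nu> = "\<lambda>_. 0"
          and R = R and t\<^sub>0 = T and T = T])
      show "\<alpha> * (of_int (N n))\<^sup>2 = \<beta> * (of_int 0)\<^sup>2 + \<gamma> * (of_int (N n - 0))\<^sup>2" for n
        using ii(1) by simp
      show "T n > 0" for n by (simp add: T_def R)
      show "T \<longlonglongrightarrow> 0"
        unfolding T_def [abs_def] R_def M_def using ii(2) by real_asymp
      have "(\<lambda>n. M n powr s * (R n)\<^sup>2 + (1 + M n powr s) * (2 * R n * exp (- (1 + real n)))\<^sup>2) \<longlonglongrightarrow> 0"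
        unfolding R_def M_def using ii(2) by real_asymp
      then show "(\<lambda>n. energy s (N n) 0 (R n) (of_int (N n - 0) * R n * (0 - T n))) \<longlonglongrightarrow> 0"
        by (rule tendsto_sandwich [OF _ _ tendsto_const, rotated -1])
          (use energy_nonneg energy_le [of s "N _" 0] in \<open>simp_all add: mult.assoc phase N M_def\<close>)
      have "filterlim (\<lambda>n. (1 + M n powr s) * (R n)\<^sup>2) at_top sequentially"
        unfolding R_def M_def using ii(2) by real_asymp
      then show "filterlim (\<lambda>n. energy s (N n) 0 (R n) (of_int (N n - 0) * R n * (T n - T n)))
          at_top sequentially"
        by (simp add: energy_0 N M_def)
    qed
  qed
qed

end
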